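(* Let $f\in L^1(\mathbb R)$. Then $f\in V_g$ if and only if the function $F\colon\mathbb R\to\mathbb R$ given by $$F(x)=\int_{-\infty}^x f(t)\,dt$$ satisfies $$F(x)=\int_{\Omega}F(L(\omega)x-M(\omega))\,P(d\omega)+G(x)$$ for every $x\in\mathbb R$.
   Context: Let $(\Omega,\mathcal A,P)$ be a complete probability space, $L,M\colon\Omega\to\mathbb R$ random variables with $L>0$ almost everywhere on $\Omega$, and $g\in L^1(\mathbb R)$ a nontrivial (nonzero) function. $V_g$ denotes the set of all $f\in L^1(\mathbb R)$ such that $$f(x)=\int_{\Omega}|L(\omega)|f(L(\omega)x-M(\omega))\,P(d\omega)+g(x)$$ for Lebesgue-almost all $x\in\mathbb R$ (this does not depend on the representative of $f$). The function $G\colon\mathbb R\to\mathbb R$ is defined by $G(x)=\int_{-\infty}^x g(t)\,dt$. *)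

theory Defs
  imports "HOL-Probability.Probability"
begin

text \<open>Elements of \<open>L\<^sup>1(\<real>)\<close> are represented by Lebesgue integrable functions, and the
  equation is required for almost every \<open>x\<close>, so membership is invariant under changing \<open>f\<close> or
  \<open>g\<close> on a null set whenever \<open>P\<close> is complete and \<open>L > 0\<close> almost everywhere. In that situation
  Tonelli's theorem makes the integrand integrable over \<open>P\<close> for almost every \<open>x\<close>, so the default
  value \<open>0\<close> of the integral of a non-integrable function plays no role.\<close>

definition V ::
  "'a measure \<Rightarrow> ('a \<Rightarrow> real) \<Rightarrow> ('a \<Rightarrow> real) \<Rightarrow> (real \<Rightarrow> real) \<Rightarrow> (real \<Rightarrow> real) set"
  where
  "V P L M g = {f. integrable lebesgue f \<and>
     (AE x in lebesgue. f x = (\<integral>\<omega>. \<bar>L \<omega>\<bar> * f (L \<omega> * x - M \<omega>) \<partial>P) + g x)}"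

definition primitive :: "(real \<Rightarrow> real) \<Rightarrow> real \<Rightarrow> real"
  where "primitive f x = (LINT t:{..x}|lebesgue. f t)"

end

theory Submission
  imports Defs
begin

text \<open>Write \<open>T f x = (\<integral>\<omega>. \<bar>L \<omega>\<bar> * f (L \<omega> * x - M \<omega>) \<partial>P)\<close>. The theorem says that taking primitives
  turns the equation \<open>f = T f + g\<close> into \<open>F = S F + G\<close>, where \<open>S F x\<close> is the integral of
  \<open>F (L \<omega> * x - M \<omega>)\<close> over \<open>\<omega>\<close>, and that nothing is lost on the way.

  For fixed \<open>\<omega>\<close> the substitution \<open>t \<mapsto> L \<omega> * t - M \<omega>\<close> maps \<open>{..x}\<close> onto \<open>{..L \<omega> * x - M \<omega>}\<close>, because
  \<open>L \<omega> > 0\<close>, and its Jacobian is the factor \<open>\<bar>L \<omega>\<bar>\<close>. The same Jacobian makes the substitution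
  norm-preserving on \<open>L\<^sup>1(\<real>)\<close>, so the integrand of \<open>T f\<close> is integrable in both variables together
  and Fubini's theorem gives that the primitive of \<open>T f\<close> is \<open>S F\<close>
  (\<open>integrable_pair_affine_pullback\<close>, \<open>integral_atMost_averaged_pullback\<close>). Hence the primitive of
  the integrable function \<open>f - T f - g\<close> is \<open>F - S F - G\<close>, and an integrable function vanishes almost
  everywhere iff its primitive vanishes identically (\<open>AE_zero_iff_integral_atMost_zero\<close>).

  Fubini's theorem needs joint measurability of \<open>f (L \<omega> * x - M \<omega>)\<close>, which can fail for a merely
  Lebesgue measurable \<open>f\<close>. Therefore \<open>f\<close> is replaced by a Borel function \<open>f\<^sub>0\<close> equal to it almost
  everywhere. That \<open>T f = T f\<^sub>0\<close> almost everywhere is where completeness of \<open>P\<close> enters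
  (\<open>AE_averaged_pullback_cong\<close>).\<close>

section \<open>Borel representatives and primitives\<close>

lemma integrable_lebesgue_borel_representative:
  fixes f :: "real \<Rightarrow> real"
  assumes f: "integrable lebesgue f"
  obtains f\<^sub>0 where "integrable lborel f\<^sub>0" "AE x in lborel. f x = f\<^sub>0 x"
proof -
  obtain f\<^sub>0 where f\<^sub>0: "f\<^sub>0 \<in> borel_measurable lborel" "AE x in lborel. f x = f\<^sub>0 x"
    using completion_ex_borel_measurable_real[OF borel_measurable_integrable[OF f]] by auto
  have "integrable lebesgue f\<^sub>0"
    by (rule Bochner_Integration.integrable_cong_AE_imp[OF f measurable_completion[OF f\<^sub>0(1)]])
      (use f\<^sub>0(2) in \<open>auto intro!: AE_completion elim: eventually_mono\<close>)
  then have "integrable lborel f\<^sub>0"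
    using integrable_completion[OF f\<^sub>0(1)] by simp
  then show thesis
    using that f\<^sub>0(2) by blast
qed

lemma primitive_eq_integral_lborel:
  assumes f: "integrable lebesgue f" and f\<^sub>0: "integrable lborel f\<^sub>0"
    and eq: "AE x in lborel. f x = f\<^sub>0 x"
  shows "primitive f x = (\<integral>t. indicator {..x} t * f\<^sub>0 t \<partial>lborel)"
proof -
  have m: "(\<lambda>t. indicator {..x} t * f\<^sub>0 t) \<in> borel_measurable lborel"
    using f\<^sub>0 by measurable
  have "primitive f x = (\<integral>t. indicator {..x} t * f t \<partial>lebesgue)"
    by (simp add: primitive_def set_lebesgue_integral_def)
  also have "\<dots> = (\<integral>t. indicator {..x} t * f\<^sub>0 t \<partial>lebesgue)"
  proof (rule integral_cong_AE)
    have "indicator {..x} \<in> borel_measurable (lebesgue :: real measure)"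
      by (rule measurable_completion) measurable
    then show "(\<lambda>t. indicator {..x} t * f t) \<in> borel_measurable lebesgue"
      by (intro borel_measurable_times borel_measurable_integrable[OF f])
    show "(\<lambda>t. indicator {..x} t * f\<^sub>0 t) \<in> borel_measurable lebesgue"
      by (rule measurable_completion[OF m])
    show "AE t in lebesgue. indicator {..x} t * f t = indicator {..x} t * f\<^sub>0 t"
      using AE_completion[OF eq] by eventually_elim simp
  qed
  also have "\<dots> = (\<integral>t. indicator {..x} t * f\<^sub>0 t \<partial>lborel)"
    by (rule integral_completion[OF m])
  finally show ?thesis .
qed

lemma integrable_indicator_times:
  fixes h :: "'a \<Rightarrow> real"
  assumes "integrable N h" "A \<in> sets N"
  shows "integrable N (\<lambda>t. indicator A t * h t)"
  using integrable_mult_indicator[OF assms(2,1)] by simp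

lemma finite_borel_measure_density_lborel:
  fixes u :: "real \<Rightarrow> real"
  assumes u: "integrable lborel u" and nn: "\<And>x. 0 \<le> u x"
  shows "finite_borel_measure (density lborel u)"
    and "cdf (density lborel u) x = (\<integral>t. indicator {..x} t * u t \<partial>lborel)"
proof -
  have [measurable]: "u \<in> borel_measurable borel"
    using u by (auto dest: borel_measurable_integrable)
  have em: "emeasure (density lborel u) A = ennreal (\<integral>t. indicator A t * u t \<partial>lborel)"
    if A: "A \<in> sets borel" for A
  proof -
    have "emeasure (density lborel u) A = (\<integral>\<^sup>+t. ennreal (indicator A t * u t) \<partial>lborel)"
      using A by (auto simp: emeasure_density intro!: nn_integral_cong split: split_indicator)
    also have "\<dots> = ennreal (\<integral>t. indicator A t * u t \<partial>lborel)"
      using A by (intro nn_integral_eq_integral integrable_indicator_times u)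
        (auto simp: nn)
    finally show ?thesis .
  qed
  show "finite_borel_measure (density lborel u)"
    by (intro finite_borel_measure.intro finite_borel_measure_axioms.intro finite_measureI)
      (simp_all add: em)
  show "cdf (density lborel u) x = (\<integral>t. indicator {..x} t * u t \<partial>lborel)"
    by (auto simp: cdf_def measure_def em nn intro!: enn2real_ennreal Bochner_Integration.integral_nonneg)
qed

text \<open>The positive and the negative part of \<open>h\<close> are densities of two finite measures. If all
  integrals over half-lines vanish, these measures have the same distribution function, so they
  coincide and so do their densities.\<close>

lemma AE_zero_iff_integral_atMost_zero:
  fixes h :: "real \<Rightarrow> real"
  assumes h: "integrable lborel h"
  shows "(AE x in lborel. h x = 0) \<longleftrightarrow> (\<forall>x. (\<integral>t. indicator {..x} t * h t \<partial>lborel) = 0)"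
proof
  assume ae: "AE x in lborel. h x = 0"
  show "\<forall>x. (\<integral>t. indicator {..x} t * h t \<partial>lborel) = 0"
  proof
    fix x
    have "AE t in lborel. indicator {..x} t * h t = 0"
      using ae by eventually_elim simp
    then show "(\<integral>t. indicator {..x} t * h t \<partial>lborel) = 0"
      by (rule integral_eq_zero_AE)
  qed
next
  assume z: "\<forall>x. (\<integral>t. indicator {..x} t * h t \<partial>lborel) = 0"
  define p n where "p x = max 0 (h x)" and "n x = max 0 (- h x)" for x
  have p: "integrable lborel p" and n: "integrable lborel n"
    unfolding p_def n_def using h by auto
  have h_eq: "h x = p x - n x" for x
    by (auto simp: p_def n_def)
  have nn: "0 \<le> p x" "0 \<le> n x" for x
    by (auto simp: p_def n_def)
  have "cdf (density lborel p) x = cdf (density lborel n) x" for x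
  proof -
    have "0 = (\<integral>t. indicator {..x} t * p t - indicator {..x} t * n t \<partial>lborel)"
      using z[rule_format, of x] by (simp add: h_eq algebra_simps)
    also have "\<dots> = (\<integral>t. indicator {..x} t * p t \<partial>lborel) - (\<integral>t. indicator {..x} t * n t \<partial>lborel)"
      by (intro Bochner_Integration.integral_diff integrable_indicator_times p n) auto
    finally show ?thesis
      by (simp add: finite_borel_measure_density_lborel(2) p n nn)
  qed
  then have "density lborel p = density lborel n"
    by (intro cdf_unique' finite_borel_measure_density_lborel(1) p n nn ext)
  then have "AE x in lborel. ennreal (p x) = ennreal (n x)"
    using p n by (intro sigma_finite_measure.density_unique[OF lborel.sigma_finite_measure_axioms])
      (auto dest!: borel_measurable_integrable)
  then show "AE x in lborel. h x = 0"
    by eventually_elim (auto simp: h_eq nn)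
qed

section \<open>Averages of random affine pullbacks\<close>

definition averaged_pullback ::
  "'a measure \<Rightarrow> ('a \<Rightarrow> real) \<Rightarrow> ('a \<Rightarrow> real) \<Rightarrow> (real \<Rightarrow> real) \<Rightarrow> real \<Rightarrow> real"
  where "averaged_pullback P L M f x = (\<integral>\<omega>. \<bar>L \<omega>\<bar> * f (L \<omega> * x - M \<omega>) \<partial>P)"

lemma affine_pullback_lborel:
  fixes f :: "real \<Rightarrow> real"
  assumes f: "integrable lborel f" and l: "l \<noteq> 0"
  shows "integrable lborel (\<lambda>x. \<bar>l\<bar> * f (l * x - m))"
    and "(\<integral>x. \<bar>l\<bar> * f (l * x - m) \<partial>lborel) = integral\<^sup>L lborel f"
  using lborel_integrable_real_affine[OF f l, of "-m"] lborel_integral_real_affine[OF l, of f "-m"]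
  by (auto simp: algebra_simps)

context
  fixes P :: "'a measure" and L M :: "'a \<Rightarrow> real"
  assumes prob: "prob_space P"
    and L [measurable]: "L \<in> borel_measurable P" and M [measurable]: "M \<in> borel_measurable P"
    and L_pos: "AE \<omega> in P. L \<omega> > 0"
begin

lemma pair_sigma_finite_lborel: "pair_sigma_finite P lborel"
  using prob by (intro pair_sigma_finite.intro lborel.sigma_finite_measure_axioms)
    (simp add: prob_space_def finite_measure_def)

text \<open>The inner integral of the norm is \<open>\<integral>\<bar>f\<bar>\<close> for almost every \<open>\<omega>\<close>, hence it is integrable over the
  probability space.\<close>

lemma integrable_pair_affine_pullback:
  fixes f :: "real \<Rightarrow> real"
  assumes f: "integrable lborel f"
  shows "integrable (P \<Otimes>\<^sub>M lborel) (\<lambda>(\<omega>, x). \<bar>L \<omega>\<bar> * f (L \<omega> * x - M \<omega>))"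
proof -
  interpret pair_sigma_finite P lborel by (rule pair_sigma_finite_lborel)
  interpret P: prob_space P by (rule prob)
  have [measurable]: "f \<in> borel_measurable borel"
    using f by (auto dest: borel_measurable_integrable)
  show ?thesis
  proof (rule Fubini_integrable)
    have "integrable P (\<lambda>\<omega>. \<integral>x. \<bar>f x\<bar> \<partial>lborel)"
      by simp
    then have "integrable P (\<lambda>\<omega>. \<integral>x. \<bar>L \<omega>\<bar> * \<bar>f (L \<omega> * x - M \<omega>)\<bar> \<partial>lborel)"
    proof (rule Bochner_Integration.integrable_cong_AE_imp)
      show "AE \<omega> in P. (\<integral>x. \<bar>f x\<bar> \<partial>lborel) = (\<integral>x. \<bar>L \<omega>\<bar> * \<bar>f (L \<omega> * x - M \<omega>)\<bar> \<partial>lborel)"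
        using L_pos
      proof eventually_elim
        case (elim \<omega>)
        then show ?case
          using affine_pullback_lborel(2)[OF integrable_abs[OF f], of "L \<omega>" "M \<omega>"] by simp
      qed
    qed measurable
    then show "integrable P (\<lambda>\<omega>. \<integral>x. norm (case (\<omega>, x) of (\<omega>, x) \<Rightarrow> \<bar>L \<omega>\<bar> * f (L \<omega> * x - M \<omega>)) \<partial>lborel)"
      by (simp add: abs_mult)
    show "AE \<omega> in P. integrable lborel (\<lambda>x. case (\<omega>, x) of (\<omega>, x) \<Rightarrow> \<bar>L \<omega>\<bar> * f (L \<omega> * x - M \<omega>))"
      using L_pos
    proof eventually_elim
      case (elim \<omega>)
      then show ?case
        using affine_pullback_lborel(1)[OF f, of "L \<omega>" "M \<omega>"] by simp
    qed
  qed measurable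
qed

lemma integrable_averaged_pullback:
  assumes "integrable lborel f"
  shows "integrable lborel (averaged_pullback P L M f)"
proof -
  interpret pair_sigma_finite P lborel by (rule pair_sigma_finite_lborel)
  show ?thesis
    unfolding averaged_pullback_def
    by (rule integrable_snd[OF integrable_pair_affine_pullback[OF assms]])
qed

text \<open>This is Fubini's theorem followed, for fixed \<open>\<omega>\<close>, by the substitution \<open>s = L \<omega> * t - M \<omega>\<close>, under
  which \<open>t \<le> x\<close> becomes \<open>s \<le> L \<omega> * x - M \<omega>\<close>.\<close>

lemma integral_atMost_averaged_pullback:
  assumes f: "integrable lborel f"
  shows "(\<integral>t. indicator {..x} t * averaged_pullback P L M f t \<partial>lborel)
    = (\<integral>\<omega>. (\<integral>t. indicator {..L \<omega> * x - M \<omega>} t * f t \<partial>lborel) \<partial>P)"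
proof -
  interpret pair_sigma_finite P lborel by (rule pair_sigma_finite_lborel)
  have [measurable]: "f \<in> borel_measurable borel"
    using f by (auto dest: borel_measurable_integrable)
  let ?h = "\<lambda>\<omega> t. indicator {..x} t * (\<bar>L \<omega>\<bar> * f (L \<omega> * t - M \<omega>))"
  have "integrable (P \<Otimes>\<^sub>M lborel)
      (\<lambda>z. indicator (space P \<times> {..x}) z * (case z of (\<omega>, t) \<Rightarrow> \<bar>L \<omega>\<bar> * f (L \<omega> * t - M \<omega>)))"
    by (intro integrable_indicator_times integrable_pair_affine_pullback f) auto
  then have int: "integrable (P \<Otimes>\<^sub>M lborel) (case_prod ?h)"
    by (rule Bochner_Integration.integrable_cong[THEN iffD1, rotated 2])
      (auto simp: space_pair_measure indicator_def)
  have "(\<integral>t. indicator {..x} t * averaged_pullback P L M f t \<partial>lborel)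
      = (\<integral>t. (\<integral>\<omega>. ?h \<omega> t \<partial>P) \<partial>lborel)"
    by (simp add: averaged_pullback_def)
  also have "\<dots> = (\<integral>\<omega>. (\<integral>t. ?h \<omega> t \<partial>lborel) \<partial>P)"
    by (rule Fubini_integral[OF int])
  also have "\<dots> = (\<integral>\<omega>. (\<integral>t. indicator {..L \<omega> * x - M \<omega>} t * f t \<partial>lborel) \<partial>P)"
  proof (rule integral_cong_AE)
    show "(\<lambda>\<omega>. \<integral>t. ?h \<omega> t \<partial>lborel) \<in> borel_measurable P"
      by measurable
    have "Measurable.pred (P \<Otimes>\<^sub>M lborel) (\<lambda>z. snd z \<le> L (fst z) * x - M (fst z))"
      by measurable
    then have "(\<lambda>(\<omega>, t). (if t \<le> L \<omega> * x - M \<omega> then 1 else 0) * f t) \<in> borel_measurable (P \<Otimes>\<^sub>M lborel)"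
      by measurable
    then have "(\<lambda>\<omega>. \<integral>t. (if t \<le> L \<omega> * x - M \<omega> then 1 else 0) * f t \<partial>lborel) \<in> borel_measurable P"
      by measurable
    also have "(\<lambda>\<omega>. \<integral>t. (if t \<le> L \<omega> * x - M \<omega> then 1 else 0) * f t \<partial>lborel)
        = (\<lambda>\<omega>. \<integral>t. indicator {..L \<omega> * x - M \<omega>} t * f t \<partial>lborel)"
      by (intro ext Bochner_Integration.integral_cong) (auto simp: indicator_def)
    finally show "(\<lambda>\<omega>. \<integral>t. indicator {..L \<omega> * x - M \<omega>} t * f t \<partial>lborel) \<in> borel_measurable P" .
    show "AE \<omega> in P. (\<integral>t. ?h \<omega> t \<partial>lborel) = (\<integral>t. indicator {..L \<omega> * x - M \<omega>} t * f t \<partial>lborel)"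
      using L_pos
    proof eventually_elim
      case (elim \<omega>)
      let ?k = "\<lambda>s. indicator {..L \<omega> * x - M \<omega>} s * f s"
      have "?h \<omega> t = \<bar>L \<omega>\<bar> * ?k (L \<omega> * t - M \<omega>)" for t
        using elim by (auto simp: indicator_def)
      then have "(\<integral>t. ?h \<omega> t \<partial>lborel) = (\<integral>t. \<bar>L \<omega>\<bar> * ?k (L \<omega> * t - M \<omega>) \<partial>lborel)"
        by (intro Bochner_Integration.integral_cong refl)
      also have "\<dots> = integral\<^sup>L lborel ?k"
        using elim by (intro affine_pullback_lborel(2) integrable_indicator_times f) auto
      finally show ?case .
    qed
  qed
  finally show ?thesis .
qed

text \<open>The affine maps \<open>x \<mapsto> L \<omega> * x - M \<omega>\<close> pull null sets back to null sets, so the exceptional set has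
  measure zero in almost every \<open>\<omega>\<close>-section, and by Tonelli in almost every \<open>x\<close>-section.\<close>

lemma AE_affine_pullback:
  assumes ae: "AE y in lborel. Q y"
  shows "AE x in lborel. AE \<omega> in P. Q (L \<omega> * x - M \<omega>)"
proof -
  interpret pair_sigma_finite P lborel by (rule pair_sigma_finite_lborel)
  obtain N where N: "{y \<in> space lborel. \<not> Q y} \<subseteq> N" "N \<in> null_sets lborel"
    using ae by (auto elim!: AE_E3 simp: eventually_ae_filter)
  have [measurable]: "N \<in> sets borel"
    using N(2) by auto
  have N_AE: "AE y in lborel. y \<notin> N"
    by (rule AE_not_in[OF N(2)])
  have "AE \<omega> in P. AE x in lborel. L \<omega> * x - M \<omega> \<notin> N"
    using L_pos
  proof eventually_elim
    case (elim \<omega>)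
    then show ?case
      using AE_borel_affine[of "L \<omega>" "\<lambda>y. y \<notin> N" "- M \<omega>"] N_AE by (simp add: algebra_simps)
  qed
  moreover have "{z \<in> space (P \<Otimes>\<^sub>M lborel). L (fst z) * snd z - M (fst z) \<notin> N} \<in> sets (P \<Otimes>\<^sub>M lborel)"
    by measurable
  ultimately have "AE x in lborel. AE \<omega> in P. L \<omega> * x - M \<omega> \<notin> N"
    using AE_commute[of "\<lambda>\<omega> x. L \<omega> * x - M \<omega> \<notin> N"] by simp
  then show ?thesis
  proof eventually_elim
    case (elim x)
    then show ?case
      by eventually_elim (use N(1) in auto)
  qed
qed

text \<open>The integrand built from \<open>f\<close> is only known to agree almost everywhere with the measurable one
  built from the Borel function \<open>f\<^sub>0\<close>; completeness of \<open>P\<close> makes it measurable as well, without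
  which the two Bochner integrals could differ.\<close>

lemma AE_averaged_pullback_cong:
  assumes compl: "complete_measure P"
    and f\<^sub>0: "f\<^sub>0 \<in> borel_measurable borel" and eq: "AE y in lborel. f y = f\<^sub>0 y"
  shows "AE x in lborel. averaged_pullback P L M f x = averaged_pullback P L M f\<^sub>0 x"
  using AE_affine_pullback[OF eq]
proof eventually_elim
  case (elim x)
  interpret P: complete_measure P by (rule compl)
  let ?u = "\<lambda>\<omega>. \<bar>L \<omega>\<bar> * f (L \<omega> * x - M \<omega>)" and ?v = "\<lambda>\<omega>. \<bar>L \<omega>\<bar> * f\<^sub>0 (L \<omega> * x - M \<omega>)"
  have v: "?v \<in> borel_measurable P"
    using f\<^sub>0 by measurable
  have uv: "AE \<omega> in P. ?u \<omega> = ?v \<omega>"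
    using elim by eventually_elim simp
  have "?u \<in> borel_measurable P"
  proof (rule measurableI)
    fix A :: "real set" assume A: "A \<in> sets borel"
    show "?u -` A \<inter> space P \<in> sets P"
    proof (rule P.in_sets_AE)
      show "?v -` A \<inter> space P \<in> sets P"
        by (rule measurable_sets[OF v A])
      show "AE \<omega> in P. \<omega> \<in> ?v -` A \<inter> space P \<longleftrightarrow> \<omega> \<in> ?u -` A \<inter> space P"
        using uv by eventually_elim (simp only: vimage_eq Int_iff)
    qed auto
  qed auto
  then show ?case
    unfolding averaged_pullback_def by (rule integral_cong_AE[OF _ v uv])
qed

end

section \<open>The equation for densities and the equation for primitives\<close>

theorem proposition3p1:
  fixes P :: "'a measure" and L M :: "'a \<Rightarrow> real" and f g F G :: "real \<Rightarrow> real"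
  assumes "prob_space P" and "complete_measure P"
    and "L \<in> borel_measurable P" and "M \<in> borel_measurable P"
    and "AE \<omega> in P. L \<omega> > 0"
    and "integrable lebesgue g" and "\<not> (AE x in lebesgue. g x = 0)"
    and "G = primitive g"
    and "integrable lebesgue f"
    and "F = primitive f"
  shows "f \<in> V P L M g \<longleftrightarrow> (\<forall>x. F x = (\<integral>\<omega>. F (L \<omega> * x - M \<omega>) \<partial>P) + G x)"
proof -
  note PLM = assms(1,3,4,5)
  obtain f\<^sub>0 where f\<^sub>0: "integrable lborel f\<^sub>0" "AE x in lborel. f x = f\<^sub>0 x"
    using integrable_lebesgue_borel_representative[OF assms(9)] .
  obtain g\<^sub>0 where g\<^sub>0: "integrable lborel g\<^sub>0" "AE x in lborel. g x = g\<^sub>0 x"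
    using integrable_lebesgue_borel_representative[OF assms(6)] .
  have F: "F x = (\<integral>t. indicator {..x} t * f\<^sub>0 t \<partial>lborel)" for x
    using primitive_eq_integral_lborel[OF assms(9) f\<^sub>0] assms(10) by simp
  have G: "G x = (\<integral>t. indicator {..x} t * g\<^sub>0 t \<partial>lborel)" for x
    using primitive_eq_integral_lborel[OF assms(6) g\<^sub>0] assms(8) by simp
  let ?T = "averaged_pullback P L M"
  have T: "integrable lborel (?T f\<^sub>0)"
    by (rule integrable_averaged_pullback[OF PLM f\<^sub>0(1)])
  define h where "h x = f\<^sub>0 x - ?T f\<^sub>0 x - g\<^sub>0 x" for x
  have h: "integrable lborel h"
    unfolding h_def using f\<^sub>0(1) g\<^sub>0(1) T by simp
  have Tcong: "AE x in lborel. ?T f x = ?T f\<^sub>0 x"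
    using f\<^sub>0 by (intro AE_averaged_pullback_cong[OF PLM assms(2)])
      (auto dest: borel_measurable_integrable)
  have "f \<in> V P L M g \<longleftrightarrow> (AE x in lborel. f x = ?T f x + g x)"
    by (simp add: V_def averaged_pullback_def assms(9) AE_completion_iff)
  also have "\<dots> \<longleftrightarrow> (AE x in lborel. h x = 0)"
  proof (rule eventually_cong)
    show "AE x in lborel. f x = f\<^sub>0 x \<and> g x = g\<^sub>0 x \<and> ?T f x = ?T f\<^sub>0 x"
      using f\<^sub>0(2) g\<^sub>0(2) Tcong by eventually_elim simp
  qed (auto simp: h_def)
  also have "\<dots> \<longleftrightarrow> (\<forall>x. (\<integral>t. indicator {..x} t * h t \<partial>lborel) = 0)"
    by (rule AE_zero_iff_integral_atMost_zero[OF h])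
  finally have main: "f \<in> V P L M g \<longleftrightarrow> (\<forall>x. (\<integral>t. indicator {..x} t * h t \<partial>lborel) = 0)" .
  have prim: "(\<integral>t. indicator {..x} t * h t \<partial>lborel) = F x - (\<integral>\<omega>. F (L \<omega> * x - M \<omega>) \<partial>P) - G x" for x
  proof -
    have "(\<integral>t. indicator {..x} t * h t \<partial>lborel)
        = (\<integral>t. indicator {..x} t * f\<^sub>0 t - indicator {..x} t * ?T f\<^sub>0 t - indicator {..x} t * g\<^sub>0 t \<partial>lborel)"
      by (simp add: h_def algebra_simps)
    also have "\<dots> = F x - (\<integral>t. indicator {..x} t * ?T f\<^sub>0 t \<partial>lborel) - G x"
      by (simp add: F G integrable_indicator_times f\<^sub>0(1) g\<^sub>0(1) T)
    also have "(\<integral>t. indicator {..x} t * ?T f\<^sub>0 t \<partial>lborel) = (\<integral>\<omega>. F (L \<omega> * x - M \<omega>) \<partial>P)"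
      by (simp add: integral_atMost_averaged_pullback[OF PLM f\<^sub>0(1)] F)
    finally show ?thesis .
  qed
  show ?thesis
    unfolding main prim by (simp only: diff_eq_eq add_0 add.commute)
qed

end
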